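(* Let $K\subset\mathbb{H}^n$, $n\geq2$, be a convex body and $p\in\mathrm{int}\,K$ a fixed interior point. Then $$\mathrm{diam}\,K=\max\{w_L(K,(p,H)) : H\text{ is a hyperplane containing }p\}.$$
   Context: $\mathbb{H}^n$ is $n$-dimensional hyperbolic space with geodesic distance $d$. A convex body is a compact (geodesically) convex set with non-empty interior. Leichtweiss width: for a hyperplane $H$ let $H^{(\varepsilon)}=\{x:d(x,H)\le\varepsilon\}$. For $p\in\mathrm{int}\,K$ and a hyperplane $H\ni p$ bounding closed half-spaces $H^+,H^-$, the supporting hyperspherical domain is the closed set $\mathcal{A}\supset K$ bounded by the component of $\partial H^{(\varepsilon)}$ in $H^+$ and the component of $\partial H^{(\varepsilon')}$ in $H^-$, both of which meet $K$; then $w_L(K,(p,H))=\varepsilon+\varepsilon'$. Equivalently, $w_L(K,(p,H))=\max_{x\in K\cap H^+}d(x,H)+\max_{x\in K\cap H^-}d(x,H)$. *)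

theory Defs
  imports "HOL-Analysis.Analysis"
begin

section \<open>Hyperbolic space\<close>

text \<open>
  We use the hyperboloid model: hyperbolic \<open>n\<close>-space is the upper sheet of the unit hyperboloid
  in Lorentzian \<open>(n + 1)\<close>-space \<open>'a \<times> real\<close>, where \<open>'a\<close> is a Euclidean space of dimension
  \<open>n = DIM('a)\<close> and the last coordinate is the time coordinate.  The curvature is \<open>-1\<close>.
\<close>

definition lorentz :: "'a::euclidean_space \<times> real \<Rightarrow> 'a \<times> real \<Rightarrow> real"
  where "lorentz x y = fst x \<bullet> fst y - snd x * snd y"

typedef (overloaded) 'a hyperbolic =
  "{x :: 'a::euclidean_space \<times> real. lorentz x x = -1 \<and> 0 < snd x}"
  morphisms vec_of Abs_hyperbolic
  by (rule exI[of _ "(0, 1)"]) (simp add: lorentz_def)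

lemma lorentz_vec_of_self [simp]: "lorentz (vec_of x) (vec_of x) = -1"
  and snd_vec_of_pos [simp]: "0 < snd (vec_of x)"
  using vec_of[of x] by auto

lemma lorentz_commute: "lorentz x y = lorentz y x"
  by (simp add: lorentz_def inner_commute mult.commute)

lemma lorentz_add_left: "lorentz (x + y) z = lorentz x z + lorentz y z"
  and lorentz_add_right: "lorentz z (x + y) = lorentz z x + lorentz z y"
  and lorentz_diff_left: "lorentz (x - y) z = lorentz x z - lorentz y z"
  and lorentz_diff_right: "lorentz z (x - y) = lorentz z x - lorentz z y"
  and lorentz_scaleR_left: "lorentz (c *\<^sub>R x) z = c * lorentz x z"
  and lorentz_scaleR_right: "lorentz z (c *\<^sub>R x) = c * lorentz z x"
  by (simp_all add: lorentz_def algebra_simps)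

lemmas lorentz_simps = lorentz_add_left lorentz_add_right lorentz_diff_left lorentz_diff_right
  lorentz_scaleR_left lorentz_scaleR_right

lemma lorentz_orthogonal_nonneg:
  assumes "lorentz v (vec_of y) = 0"
  shows "0 \<le> lorentz v v" and "lorentz v v = 0 \<Longrightarrow> v = 0"
proof -
  obtain a s where v: "v = (a, s)" by fastforce
  obtain b t where y: "vec_of y = (b, t)" by fastforce
  have t: "0 < t" "t\<^sup>2 = 1 + b \<bullet> b"
    using snd_vec_of_pos[of y] lorentz_vec_of_self[of y]
    by (auto simp: y lorentz_def power2_eq_square)
  have "a \<bullet> b = s * t"
    using assms by (simp add: v y lorentz_def)
  then have "s\<^sup>2 * t\<^sup>2 \<le> (a \<bullet> a) * (b \<bullet> b)"
    using Cauchy_Schwarz_ineq[of a b] by (simp add: power_mult_distrib)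
  moreover have "(a \<bullet> a) * (b \<bullet> b) = (a \<bullet> a) * t\<^sup>2 - a \<bullet> a"
    using t by (simp add: algebra_simps)
  ultimately have *: "a \<bullet> a \<le> (a \<bullet> a - s\<^sup>2) * t\<^sup>2"
    by (simp add: algebra_simps)
  have "0 \<le> (a \<bullet> a - s\<^sup>2) * t\<^sup>2"
    using * inner_ge_zero[of a] by linarith
  then have "0 \<le> a \<bullet> a - s\<^sup>2"
    using t(1) by (simp add: zero_le_mult_iff)
  then show "0 \<le> lorentz v v"
    by (simp add: v lorentz_def power2_eq_square)
  show "v = 0" if "lorentz v v = 0"
  proof -
    have eq: "a \<bullet> a - s\<^sup>2 = 0"
      using that by (simp add: v lorentz_def power2_eq_square)
    then have "a \<bullet> a \<le> 0"
      using * by simp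
    then have "a = 0"
      by (metis inner_gt_zero_iff not_le)
    with eq v show ?thesis by (simp add: zero_prod_def)
  qed
qed

lemma lorentz_orthogonal_Cauchy_Schwarz:
  assumes "lorentz v (vec_of y) = 0" "lorentz w (vec_of y) = 0"
  shows "\<bar>lorentz v w\<bar> \<le> sqrt (lorentz v v) * sqrt (lorentz w w)"
proof -
  have nn: "0 \<le> lorentz v v" "0 \<le> lorentz w w"
    using assms by (auto intro: lorentz_orthogonal_nonneg)
  have "(lorentz v w)\<^sup>2 \<le> lorentz v v * lorentz w w"
  proof (cases "lorentz w w = 0")
    case True
    then have "w = 0" using lorentz_orthogonal_nonneg(2) assms by blast
    then show ?thesis by (simp add: lorentz_def)
  next
    case False
    let ?u = "lorentz w w *\<^sub>R v - lorentz v w *\<^sub>R w"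
    have "0 \<le> lorentz ?u ?u"
      by (rule lorentz_orthogonal_nonneg(1)[of _ y]) (simp add: lorentz_simps assms)
    also have "lorentz ?u ?u = lorentz w w * (lorentz v v * lorentz w w - (lorentz v w)\<^sup>2)"
      using lorentz_commute[of w v] by (simp add: lorentz_simps power2_eq_square algebra_simps)
    finally show ?thesis
      using False nn by (simp add: zero_le_mult_iff)
  qed
  then have "sqrt ((lorentz v w)\<^sup>2) \<le> sqrt (lorentz v v * lorentz w w)"
    by (rule real_sqrt_le_mono)
  then show ?thesis by (simp add: real_sqrt_mult)
qed

lemma lorentz_vec_of_ge_1: "1 \<le> - lorentz (vec_of x) (vec_of y)"
  and lorentz_vec_of_eq_1_iff: "- lorentz (vec_of x) (vec_of y) = 1 \<longleftrightarrow> x = y"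
proof -
  let ?c = "- lorentz (vec_of x) (vec_of y)"
  let ?v = "vec_of x - ?c *\<^sub>R vec_of y"
  have o: "lorentz ?v (vec_of y) = 0"
    by (simp add: lorentz_simps)
  have vv: "lorentz ?v ?v = ?c\<^sup>2 - 1"
    using lorentz_commute[of "vec_of y" "vec_of x"]
    by (simp add: lorentz_simps power2_eq_square algebra_simps)
  have sq: "1 \<le> ?c\<^sup>2"
    using lorentz_orthogonal_nonneg(1)[OF o] vv by linarith
  have "fst (vec_of x) \<bullet> fst (vec_of y) < snd (vec_of x) * snd (vec_of y)"
  proof -
    have lt: "norm (fst (vec_of z)) < snd (vec_of z)" for z :: "'a hyperbolic"
    proof (rule power2_less_imp_less)
      show "(norm (fst (vec_of z)))\<^sup>2 < (snd (vec_of z))\<^sup>2"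
        using lorentz_vec_of_self[of z]
        by (simp add: lorentz_def power2_norm_eq_inner flip: power2_eq_square)
    qed (simp add: less_imp_le)
    have "fst (vec_of x) \<bullet> fst (vec_of y) \<le> norm (fst (vec_of x)) * norm (fst (vec_of y))"
      by (rule norm_cauchy_schwarz)
    also have "\<dots> < snd (vec_of x) * snd (vec_of y)"
      by (rule mult_strict_mono'[OF lt lt]) auto
    finally show ?thesis .
  qed
  then have "0 < ?c" by (simp add: lorentz_def)
  then show ge: "1 \<le> ?c"
    using sq power2_le_imp_le[of 1 ?c] by simp
  show "?c = 1 \<longleftrightarrow> x = y"
  proof
    assume c: "?c = 1"
    have "?v = 0"
      using lorentz_orthogonal_nonneg(2)[OF o] vv unfolding c by simp
    then have "vec_of x = vec_of y" using c by simp
    then show "x = y" by (simp add: vec_of_inject)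
  qed simp
qed

instantiation hyperbolic :: (euclidean_space) metric_space
begin

text \<open>The geodesic distance: \<open>cosh (dist x y) = - lorentz (vec_of x) (vec_of y)\<close>.\<close>

definition dist_hyperbolic :: "'a hyperbolic \<Rightarrow> 'a hyperbolic \<Rightarrow> real"
  where "dist x y = arcosh (- lorentz (vec_of x) (vec_of y))"

definition uniformity_hyperbolic :: "('a hyperbolic \<times> 'a hyperbolic) filter"
  where "uniformity = (INF e\<in>{0 <..}. principal {(x :: 'a hyperbolic, y). dist x y < e})"

definition open_hyperbolic_def:
  "open (U :: 'a hyperbolic set) \<longleftrightarrow> (\<forall>x\<in>U. \<forall>\<^sub>F (x', y) in uniformity. x' = x \<longrightarrow> y \<in> U)"

instance
proof
  fix x y z :: "'a hyperbolic" and U :: "'a hyperbolic set"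
  show "uniformity = (INF e\<in>{0 <..}. principal {(x :: 'a hyperbolic, y). dist x y < e})"
    by (rule uniformity_hyperbolic_def)
  show "open U \<longleftrightarrow> (\<forall>x\<in>U. \<forall>\<^sub>F (x', y) in uniformity. x' = x \<longrightarrow> y \<in> U)"
    by (rule open_hyperbolic_def)
  show "dist x y = 0 \<longleftrightarrow> x = y"
    using lorentz_vec_of_ge_1[of x y] lorentz_vec_of_eq_1_iff[of x y]
    unfolding dist_hyperbolic_def by simp
  let ?a = "- lorentz (vec_of x) (vec_of z)" and ?b = "- lorentz (vec_of y) (vec_of z)"
  let ?v = "vec_of x - ?a *\<^sub>R vec_of z" and ?w = "vec_of y - ?b *\<^sub>R vec_of z"
  have a: "1 \<le> ?a" and b: "1 \<le> ?b"
    by (rule lorentz_vec_of_ge_1)+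
  have o: "lorentz ?v (vec_of z) = 0" "lorentz ?w (vec_of z) = 0"
    by (simp_all add: lorentz_simps)
  have vv: "lorentz ?v ?v = ?a\<^sup>2 - 1" and ww: "lorentz ?w ?w = ?b\<^sup>2 - 1"
    and vw: "lorentz ?v ?w = lorentz (vec_of x) (vec_of y) + ?a * ?b"
    using lorentz_commute[of "vec_of z" "vec_of x"] lorentz_commute[of "vec_of z" "vec_of y"]
    by (simp_all add: lorentz_simps power2_eq_square algebra_simps)
  have "- lorentz (vec_of x) (vec_of y) \<le> ?a * ?b + sqrt (?a\<^sup>2 - 1) * sqrt (?b\<^sup>2 - 1)"
    using lorentz_orthogonal_Cauchy_Schwarz[OF o] unfolding vv ww vw by linarith
  also have "\<dots> = cosh (arcosh ?a + arcosh ?b)"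
    using a b by (simp add: cosh_add sinh_arcosh_real)
  finally have "cosh (dist x y) \<le> cosh (dist x z + dist y z)"
    unfolding dist_hyperbolic_def using lorentz_vec_of_ge_1[of x y] by simp
  moreover have "0 \<le> dist x y" "0 \<le> dist x z + dist y z"
    unfolding dist_hyperbolic_def using a b lorentz_vec_of_ge_1[of x y] 
    by (auto intro!: add_nonneg_nonneg arcosh_nonneg_real)
  ultimately show "dist x y \<le> dist x z + dist y z"
    by (simp add: cosh_real_nonneg_le_iff)
qed

end

section \<open>Convex bodies\<close>

text \<open>Hyperbolic space is uniquely geodesic, so the points between \<open>x\<close> and \<open>y\<close> in the metric
  sense are those of the geodesic segment joining \<open>x\<close> and \<open>y\<close>.\<close>

definition geodesic_segment :: "'a::euclidean_space hyperbolic \<Rightarrow> 'a hyperbolic \<Rightarrow> 'a hyperbolic set"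
  where "geodesic_segment x y = {z. dist x z + dist z y = dist x y}"

definition geodesically_convex :: "'a::euclidean_space hyperbolic set \<Rightarrow> bool"
  where "geodesically_convex K \<longleftrightarrow> (\<forall>x\<in>K. \<forall>y\<in>K. geodesic_segment x y \<subseteq> K)"

definition convex_body :: "'a::euclidean_space hyperbolic set \<Rightarrow> bool"
  where "convex_body K \<longleftrightarrow> compact K \<and> geodesically_convex K \<and> interior K \<noteq> {}"

section \<open>Hyperplanes and the Leichtweiss width\<close>

text \<open>The hyperplanes are the sections of the hyperboloid by the Lorentz-orthogonal complements
  of vectors \<open>u\<close> with \<open>lorentz u u > 0\<close>; these complements are exactly the \<open>n\<close>-dimensional
  linear subspaces that meet the hyperboloid.  The two closed half-spaces bounded by
  \<open>hyperplane u\<close> are \<open>halfspace u\<close> and \<open>halfspace (- u)\<close>.\<close>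

definition spacelike :: "'a::euclidean_space \<times> real \<Rightarrow> bool"
  where "spacelike u \<longleftrightarrow> 0 < lorentz u u"

definition hyperplane :: "'a::euclidean_space \<times> real \<Rightarrow> 'a hyperbolic set"
  where "hyperplane u = {x. lorentz u (vec_of x) = 0}"

definition halfspace :: "'a::euclidean_space \<times> real \<Rightarrow> 'a hyperbolic set"
  where "halfspace u = {x. 0 \<le> lorentz u (vec_of x)}"

definition is_hyperplane :: "'a::euclidean_space hyperbolic set \<Rightarrow> bool"
  where "is_hyperplane H \<longleftrightarrow> (\<exists>u. spacelike u \<and> H = hyperplane u)"

definition nbhd :: "'a::euclidean_space hyperbolic set \<Rightarrow> real \<Rightarrow> 'a hyperbolic set"
  where "nbhd H \<epsilon> = {x. infdist x H \<le> \<epsilon>}"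

text \<open>The component of the boundary of \<open>nbhd (hyperplane u) \<epsilon>\<close> that lies in \<open>halfspace u\<close>.\<close>

definition hypersphere :: "'a::euclidean_space \<times> real \<Rightarrow> real \<Rightarrow> 'a hyperbolic set"
  where "hypersphere u \<epsilon> = frontier (nbhd (hyperplane u) \<epsilon>) \<inter> halfspace u"

text \<open>The closed region between \<open>hypersphere u \<epsilon>\<close> and \<open>hypersphere (- u) \<epsilon>'\<close>.\<close>

definition hyperspherical_domain ::
    "'a::euclidean_space \<times> real \<Rightarrow> real \<Rightarrow> real \<Rightarrow> 'a hyperbolic set"
  where "hyperspherical_domain u \<epsilon> \<epsilon>' =
    (nbhd (hyperplane u) \<epsilon> \<inter> halfspace u) \<union> (nbhd (hyperplane u) \<epsilon>' \<inter> halfspace (- u))"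

definition supporting_domain ::
    "'a::euclidean_space hyperbolic set \<Rightarrow> 'a \<times> real \<Rightarrow> real \<Rightarrow> real \<Rightarrow> bool"
  where "supporting_domain K u \<epsilon> \<epsilon>' \<longleftrightarrow>
    K \<subseteq> hyperspherical_domain u \<epsilon> \<epsilon>' \<and>
    hypersphere u \<epsilon> \<inter> K \<noteq> {} \<and> hypersphere (- u) \<epsilon>' \<inter> K \<noteq> {}"

text \<open>The width is meant only for \<open>p \<in> interior K\<close> and a hyperplane \<open>H\<close> through \<open>p\<close>.  The two
  distances \<open>\<epsilon>\<close> and \<open>\<epsilon>'\<close> are then determined by \<open>K\<close> and \<open>u\<close>, and passing to another normal
  vector of \<open>H\<close> at most interchanges them, so that their sum is unique.\<close>

definition leichtweiss_width ::
    "'a::euclidean_space hyperbolic set \<Rightarrow> 'a hyperbolic \<times> 'a hyperbolic set \<Rightarrow> real"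
  where "leichtweiss_width K = (\<lambda>(p, H). THE w. \<exists>u \<epsilon> \<epsilon>'.
    p \<in> interior K \<and> p \<in> H \<and> spacelike u \<and> H = hyperplane u \<and>
    supporting_domain K u \<epsilon> \<epsilon>' \<and> w = \<epsilon> + \<epsilon>')"

end

theory Submission
  imports Defs
begin

text \<open>
  The whole argument runs through the signed distance \<open>signed_dist u\<close> to a hyperplane with normal
  vector \<open>u\<close>.  Decomposing points as \<open>cosh s *\<^sub>R f + sinh s *\<^sub>R e\<close>, with \<open>f\<close> the foot of the
  perpendicular to the hyperplane and \<open>e\<close> the unit normal, one sees that the signed distance is
  \<open>1\<close>-Lipschitz (\<open>abs_signed_dist_diff_le_dist\<close>) and that its absolute value is the distance to
  the hyperplane (\<open>infdist_hyperplane\<close>).  Hence for a hyperplane through the interior point \<open>p\<close>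
  of \<open>K\<close> the Leichtweiss width is the maximum minus the minimum of the signed distance on \<open>K\<close>
  (\<open>leichtweiss_width_eq\<close>), and the Lipschitz property bounds it by the diameter.

  Conversely, let \<open>x\<close> and \<open>y\<close> be points of \<open>K\<close> at maximal distance.  The hyperplane through \<open>p\<close>
  orthogonal to the line through \<open>x\<close> and \<open>y\<close> has a signed distance that is an isometry along this
  line (\<open>exists_hyperplane_orthogonal_to_line\<close>), so its width is at least \<open>dist x y = diameter K\<close>.
  It does not matter where on the line this hyperplane crosses it.
\<close>

section \<open>Points of the hyperboloid and their distance\<close>

lemma cosh_dist: "cosh (dist x y) = - lorentz (vec_of x) (vec_of y)"
  using lorentz_vec_of_ge_1[of x y] by (simp add: dist_hyperbolic_def)

lemma dist_le_iff_cosh: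
  fixes x y :: "'a::euclidean_space hyperbolic"
  shows "\<bar>r\<bar> \<le> dist x y \<longleftrightarrow> cosh r \<le> - lorentz (vec_of x) (vec_of y)"
  by (metis abs_ge_zero cosh_dist cosh_real_abs cosh_real_nonneg_le_iff zero_le_dist)

lemma dist_eq_iff_cosh:
  fixes x y :: "'a::euclidean_space hyperbolic"
  shows "dist x y = \<bar>r\<bar> \<longleftrightarrow> cosh r = - lorentz (vec_of x) (vec_of y)"
  by (auto simp flip: cosh_dist)

lemma lorentz_zero_left [simp]: "lorentz 0 v = 0"
  by (simp add: lorentz_def)

lemma lorentz_minus_left [simp]: "lorentz (- u) v = - lorentz u v"
  and lorentz_minus_right [simp]: "lorentz v (- u) = - lorentz v u"
  by (simp_all add: lorentz_def)

text \<open>A unit timelike vector lies on the upper sheet, not the lower one, as soon as its Lorentz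
  product with one point of the upper sheet is negative.\<close>

lemma exists_vec_of:
  assumes "lorentz v v = -1" and "lorentz v (vec_of q) < 0"
  shows "\<exists>x. vec_of x = v"
proof -
  have "snd v \<noteq> 0"
  proof
    assume "snd v = 0"
    then have "lorentz v v = fst v \<bullet> fst v"
      by (simp add: lorentz_def)
    with assms(1) inner_ge_zero[of "fst v"] show False by simp
  qed
  moreover have "\<not> snd v < 0"
  proof
    assume "snd v < 0"
    then have "vec_of (Abs_hyperbolic (- v)) = - v"
      using assms(1) by (intro Abs_hyperbolic_inverse) simp
    then have "1 \<le> - lorentz (- v) (vec_of q)"
      by (metis lorentz_vec_of_ge_1)
    with assms(2) show False by simp
  qed
  ultimately have "vec_of (Abs_hyperbolic v) = v"
    using assms(1) by (intro Abs_hyperbolic_inverse) simp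
  then show ?thesis ..
qed

lemma spacelike_if_orthogonal:
  assumes "lorentz v (vec_of p) = 0" "v \<noteq> 0"
  shows "spacelike v"
  using lorentz_orthogonal_nonneg[OF assms(1)] assms(2) by (force simp: spacelike_def)

section \<open>Signed distance to a hyperplane\<close>

text \<open>The signed distance of \<open>x\<close> to \<open>hyperplane u\<close>, positive on the side \<open>halfspace u\<close>.  It is
  meaningful only for spacelike \<open>u\<close>, and unchanged when \<open>u\<close> is multiplied by a positive factor.\<close>

definition signed_dist :: "'a::euclidean_space \<times> real \<Rightarrow> 'a hyperbolic \<Rightarrow> real"
  where "signed_dist u x = arsinh (lorentz u (vec_of x) / sqrt (lorentz u u))"

lemma lorentz_eq_sinh_signed_dist:
  assumes "spacelike u"
  shows "lorentz u (vec_of x) = sqrt (lorentz u u) * sinh (signed_dist u x)"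
  using assms by (simp add: signed_dist_def spacelike_def)

lemma signed_dist_eqI:
  assumes "spacelike u" "lorentz u (vec_of x) = sqrt (lorentz u u) * sinh t"
  shows "signed_dist u x = t"
  using assms by (simp add: signed_dist_def spacelike_def arsinh_sinh_real)

lemma halfspace_eq_signed_dist:
  "spacelike u \<Longrightarrow> halfspace u = {x. 0 \<le> signed_dist u x}"
  by (auto simp: halfspace_def lorentz_eq_sinh_signed_dist spacelike_def zero_le_mult_iff)

lemma hyperplane_eq_signed_dist:
  "spacelike u \<Longrightarrow> hyperplane u = {x. signed_dist u x = 0}"
  by (auto simp: hyperplane_def lorentz_eq_sinh_signed_dist spacelike_def)

lemma spacelike_scaleR: "spacelike u \<Longrightarrow> c \<noteq> 0 \<Longrightarrow> spacelike (c *\<^sub>R u)"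
  by (simp add: spacelike_def lorentz_simps flip: mult.assoc power2_eq_square)

lemma signed_dist_scaleR:
  assumes "spacelike u" "c \<noteq> 0"
  shows "signed_dist (c *\<^sub>R u) x = sgn c * signed_dist u x"
proof (rule signed_dist_eqI)
  show "spacelike (c *\<^sub>R u)"
    using assms by (rule spacelike_scaleR)
  have "sinh (sgn c * t) = sgn c * sinh t" for t :: real
    using assms(2) by (auto simp: sgn_if)
  then show "lorentz (c *\<^sub>R u) (vec_of x) =
      sqrt (lorentz (c *\<^sub>R u) (c *\<^sub>R u)) * sinh (sgn c * signed_dist u x)"
    using assms(1)
    by (simp add: lorentz_simps lorentz_eq_sinh_signed_dist real_sqrt_mult sgn_if
        flip: mult.assoc)
qed

lemma signed_dist_minus: "spacelike u \<Longrightarrow> signed_dist (- u) x = - signed_dist u x"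
  using signed_dist_scaleR[of u "-1" x] by simp

lemma spacelike_minus: "spacelike u \<Longrightarrow> spacelike (- u)"
  by (simp add: spacelike_def)

text \<open>The point \<open>f\<close> is the foot of the perpendicular dropped from \<open>x\<close> to the hyperplane.\<close>

lemma foot_decomposition:
  assumes "spacelike u"
  obtains f where "f \<in> hyperplane u"
    and "vec_of x = cosh (signed_dist u x) *\<^sub>R vec_of f +
      (sinh (signed_dist u x) / sqrt (lorentz u u)) *\<^sub>R u"
proof -
  define N where "N = sqrt (lorentz u u)"
  have N: "0 < N" "lorentz u u = N * N"
    using assms by (auto simp: N_def spacelike_def)
  define t where "t = signed_dist u x"
  have ux: "lorentz u (vec_of x) = N * sinh t" "lorentz (vec_of x) u = N * sinh t"
    using lorentz_eq_sinh_signed_dist[OF assms, of x]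
    by (simp_all add: N_def t_def lorentz_commute)
  have ch: "cosh t * cosh t = 1 + sinh t * sinh t" 
    using hyperbolic_pythagoras[of t] by (simp add: power2_eq_square)
  have nz: "1 + sinh t * sinh t \<noteq> 0"
    using ch by (metis cosh_real_nonzero mult_eq_0_iff)
  define v where "v = (1 / cosh t) *\<^sub>R (vec_of x - (sinh t / N) *\<^sub>R u)"
  have "lorentz v v = -1"
    using N ch nz by (simp add: v_def lorentz_simps ux field_simps)
  moreover have "lorentz v (vec_of x) = - cosh t"
    using N ch by (simp add: v_def lorentz_simps ux field_simps)
  then have "lorentz v (vec_of x) < 0" by simp
  ultimately obtain f where f: "vec_of f = v"
    using exists_vec_of by blast
  show thesis
  proof
    show "f \<in> hyperplane u"
      using N by (simp add: hyperplane_def f v_def lorentz_simps ux)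
    show "vec_of x = cosh (signed_dist u x) *\<^sub>R vec_of f +
        (sinh (signed_dist u x) / sqrt (lorentz u u)) *\<^sub>R u"
      by (simp add: f v_def flip: t_def N_def)
  qed
qed

text \<open>With \<open>s\<close>, \<open>t\<close> the signed distances and \<open>f\<close>, \<open>g\<close> the feet of \<open>x\<close>, \<open>y\<close>, one has
  \<open>cosh (dist x y) = cosh s * cosh t * cosh (dist f g) - sinh s * sinh t \<ge> cosh (s - t)\<close>.\<close>

lemma abs_signed_dist_diff_le_dist:
  assumes "spacelike u"
  shows "\<bar>signed_dist u x - signed_dist u y\<bar> \<le> dist x y"
proof -
  let ?N = "sqrt (lorentz u u)" and ?s = "signed_dist u x" and ?t = "signed_dist u y"
  obtain f where f: "f \<in> hyperplane u" "vec_of x = cosh ?s *\<^sub>R vec_of f + (sinh ?s / ?N) *\<^sub>R u"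
    using foot_decomposition[OF assms] by blast
  obtain g where g: "g \<in> hyperplane u" "vec_of y = cosh ?t *\<^sub>R vec_of g + (sinh ?t / ?N) *\<^sub>R u"
    using foot_decomposition[OF assms] by blast
  have N: "?N \<noteq> 0" "lorentz u u = ?N * ?N"
    using assms by (auto simp: spacelike_def)
  have perp: "lorentz u (vec_of f) = 0" "lorentz u (vec_of g) = 0" "lorentz (vec_of f) u = 0"
    using f(1) g(1) by (simp_all add: hyperplane_def lorentz_commute)
  have "cosh (?s - ?t) = cosh ?s * cosh ?t * 1 - sinh ?s * sinh ?t"
    by (simp add: cosh_diff)
  also have "\<dots> \<le> cosh ?s * cosh ?t * (- lorentz (vec_of f) (vec_of g)) - sinh ?s * sinh ?t"
    by (intro diff_right_mono mult_left_mono lorentz_vec_of_ge_1) simp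
  also have "\<dots> = - lorentz (vec_of x) (vec_of y)"
  proof -
    have "lorentz (vec_of x) (vec_of y) =
        cosh ?s * cosh ?t * lorentz (vec_of f) (vec_of g) +
        (sinh ?s / ?N) * (sinh ?t / ?N) * lorentz u u"
      by (subst f(2), subst g(2)) (simp add: lorentz_simps perp)
    also have "(sinh ?s / ?N) * (sinh ?t / ?N) * lorentz u u = sinh ?s * sinh ?t"
      using N by (simp add: field_simps)
    finally show ?thesis by simp
  qed
  finally show ?thesis
    by (simp add: dist_le_iff_cosh)
qed

text \<open>The point \<open>y\<close> is found on the perpendicular to the hyperplane through \<open>x\<close>, along which the
  signed distance is an arc length parameter.\<close>

lemma exists_translate_along_perpendicular:
  assumes "spacelike u"
  shows "\<exists>y. signed_dist u y = t \<and> dist x y = \<bar>signed_dist u x - t\<bar>"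
proof -
  let ?N = "sqrt (lorentz u u)" and ?s = "signed_dist u x"
  obtain f where f: "f \<in> hyperplane u" "vec_of x = cosh ?s *\<^sub>R vec_of f + (sinh ?s / ?N) *\<^sub>R u"
    using foot_decomposition[OF assms] by blast
  have N: "?N \<noteq> 0" "lorentz u u = ?N * ?N"
    using assms by (auto simp: spacelike_def)
  have perp: "lorentz u (vec_of f) = 0" "lorentz (vec_of f) u = 0"
    using f(1) by (simp_all add: hyperplane_def lorentz_commute)
  let ?v = "\<lambda>r. cosh r *\<^sub>R vec_of f + (sinh r / ?N) *\<^sub>R u"
  have vv: "lorentz (?v r) (?v q) = - cosh (r - q)" for r q
  proof -
    have "lorentz (?v r) (?v q) = - (cosh r * cosh q) + (sinh r / ?N) * (sinh q / ?N) * lorentz u u"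
      by (simp add: lorentz_simps perp)
    also have "(sinh r / ?N) * (sinh q / ?N) * lorentz u u = sinh r * sinh q"
      using N by (simp add: field_simps)
    finally show ?thesis by (simp add: cosh_diff)
  qed
  have "lorentz (?v t) (vec_of f) < 0"
    by (simp add: lorentz_simps perp)
  then obtain y where y: "vec_of y = ?v t"
    using exists_vec_of[of "?v t" f] vv[of t t] by auto
  have "lorentz u (vec_of y) = ?N * sinh t"
    using N by (simp add: y lorentz_simps perp field_simps)
  then have "signed_dist u y = t"
    by (rule signed_dist_eqI[OF assms])
  moreover have "dist x y = \<bar>?s - t\<bar>"
    unfolding dist_eq_iff_cosh y by (subst f(2)) (simp only: vv minus_minus)
  ultimately show ?thesis by blast
qed

lemma infdist_hyperplane:
  assumes "spacelike u"
  shows "infdist x (hyperplane u) = \<bar>signed_dist u x\<bar>"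
proof -
  obtain f where f: "signed_dist u f = 0" "dist x f = \<bar>signed_dist u x\<bar>"
    using exists_translate_along_perpendicular[OF assms, of 0 x] by auto
  then have fH: "f \<in> hyperplane u"
    by (simp add: hyperplane_eq_signed_dist assms)
  show ?thesis
  proof (rule antisym)
    show "infdist x (hyperplane u) \<le> \<bar>signed_dist u x\<bar>"
      using infdist_le[OF fH, of x] f(2) by simp
    have "\<bar>signed_dist u x\<bar> \<le> dist x y" if "y \<in> hyperplane u" for y
      using abs_signed_dist_diff_le_dist[OF assms, of x y] that
      by (simp add: hyperplane_eq_signed_dist assms)
    then show "\<bar>signed_dist u x\<bar> \<le> infdist x (hyperplane u)"
      using fH by (subst infdist_notempty) (auto intro: cINF_greatest)
  qed
qed

lemma continuous_on_signed_dist: "spacelike u \<Longrightarrow> continuous_on S (signed_dist u)"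
  by (rule uniformly_continuous_imp_continuous, rule lipschitz_on_uniformly_continuous[of 1])
    (auto intro!: lipschitz_onI simp: dist_real_def abs_signed_dist_diff_le_dist)

section \<open>The Leichtweiss width in terms of the signed distance\<close>

lemma nbhd_hyperplane: "spacelike u \<Longrightarrow> nbhd (hyperplane u) \<epsilon> = {x. \<bar>signed_dist u x\<bar> \<le> \<epsilon>}"
  by (simp add: nbhd_def infdist_hyperplane)

text \<open>The case \<open>\<epsilon> = 0\<close> is included: the hyperplane has empty interior, so it is its own
  frontier.\<close>

lemma hypersphere_eq:
  assumes "spacelike u"
  shows "hypersphere u \<epsilon> = {x. signed_dist u x = \<epsilon> \<and> 0 \<le> \<epsilon>}"
proof (rule set_eqI)
  fix x :: "'a hyperbolic"
  let ?N = "nbhd (hyperplane u) \<epsilon>" and ?s = "signed_dist u"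
  have cont: "continuous_on UNIV (\<lambda>x. \<bar>?s x\<bar>)"
    by (intro continuous_intros continuous_on_signed_dist assms)
  have "closed ?N"
    unfolding nbhd_hyperplane[OF assms] by (intro closed_Collect_le cont continuous_on_const)
  then have frontier: "frontier ?N = ?N - interior ?N"
    by (simp add: frontier_def)
  have "{x. \<bar>?s x\<bar> < \<epsilon>} \<subseteq> interior ?N"
    by (rule interior_maximal)
      (auto simp: nbhd_hyperplane assms intro: open_Collect_less cont continuous_on_const)
  moreover have "x \<notin> interior ?N" if "?s x = \<epsilon>" "0 \<le> \<epsilon>"
  proof
    assume "x \<in> interior ?N"
    then obtain e where e: "0 < e" "ball x e \<subseteq> ?N"
      by (auto simp: mem_interior)
    \<comment> \<open>moving away from the hyperplane leaves the neighbourhood at once\<close>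
    obtain y where y: "?s y = \<epsilon> + e / 2" "dist x y = \<bar>?s x - (\<epsilon> + e / 2)\<bar>"
      using exists_translate_along_perpendicular[OF assms, of "\<epsilon> + e / 2" x] by blast
    have "y \<in> ball x e"
      using e(1) that y(2) by simp
    with e(2) have "y \<in> ?N" by blast
    with e(1) that y(1) show False
      by (simp add: nbhd_hyperplane assms)
  qed
  ultimately show "x \<in> hypersphere u \<epsilon> \<longleftrightarrow> x \<in> {x. ?s x = \<epsilon> \<and> 0 \<le> \<epsilon>}"
    unfolding hypersphere_def frontier halfspace_eq_signed_dist[OF assms]
    by (force simp: nbhd_hyperplane assms)
qed

text \<open>That \<open>\<epsilon>\<close> and \<open>\<epsilon>'\<close> are nonnegative need not be required on the right-hand side: it
  follows from \<open>signed_dist u p = 0\<close>.\<close>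

lemma supporting_domain_iff:
  assumes "spacelike u" "p \<in> K" "p \<in> hyperplane u"
  shows "supporting_domain K u \<epsilon> \<epsilon>' \<longleftrightarrow>
    (\<exists>x\<in>K. signed_dist u x = \<epsilon>) \<and> (\<exists>y\<in>K. signed_dist u y = - \<epsilon>') \<and>
    (\<forall>z\<in>K. - \<epsilon>' \<le> signed_dist u z \<and> signed_dist u z \<le> \<epsilon>)"
proof -
  let ?s = "signed_dist u"
  have sp: "?s p = 0"
    using assms by (simp add: hyperplane_eq_signed_dist)
  have dom: "hyperspherical_domain u \<epsilon> \<epsilon>' =
      {x. \<bar>?s x\<bar> \<le> \<epsilon> \<and> 0 \<le> ?s x \<or> \<bar>?s x\<bar> \<le> \<epsilon>' \<and> ?s x \<le> 0}"
    using assms(1)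
    by (auto simp: hyperspherical_domain_def nbhd_hyperplane halfspace_eq_signed_dist
        spacelike_minus signed_dist_minus)
  have sph: "hypersphere u \<epsilon> = {x. ?s x = \<epsilon> \<and> 0 \<le> \<epsilon>}"
    "hypersphere (- u) \<epsilon>' = {x. ?s x = - \<epsilon>' \<and> 0 \<le> \<epsilon>'}"
    using assms(1) by (auto simp: hypersphere_eq spacelike_minus signed_dist_minus)
  show ?thesis
  proof
    assume "supporting_domain K u \<epsilon> \<epsilon>'"
    then show "(\<exists>x\<in>K. ?s x = \<epsilon>) \<and> (\<exists>y\<in>K. ?s y = - \<epsilon>') \<and> (\<forall>z\<in>K. - \<epsilon>' \<le> ?s z \<and> ?s z \<le> \<epsilon>)"
      unfolding supporting_domain_def dom sph by fastforce
  next
    assume *: "(\<exists>x\<in>K. ?s x = \<epsilon>) \<and> (\<exists>y\<in>K. ?s y = - \<epsilon>') \<and> (\<forall>z\<in>K. - \<epsilon>' \<le> ?s z \<and> ?s z \<le> \<epsilon>)"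
    then have "0 \<le> \<epsilon>" "0 \<le> \<epsilon>'"
      using assms(2) sp by fastforce+
    with * show "supporting_domain K u \<epsilon> \<epsilon>'"
      unfolding supporting_domain_def dom sph by fastforce
  qed
qed

text \<open>The normal vector of a hyperplane is unique up to a factor.  The component \<open>w\<close> of \<open>v\<close>
  orthogonal to \<open>u\<close> is tangent at \<open>p\<close> to the hyperplane, so a point of the hyperplane lies in the
  span of \<open>p\<close> and \<open>w\<close>, with coefficient \<open>1\<close> at \<open>w\<close>.  As \<open>v\<close> is orthogonal to that point and
  to \<open>p\<close>, it is orthogonal to \<open>w\<close>; so \<open>w\<close> is orthogonal to itself and therefore zero.\<close>

lemma hyperplane_eq_imp_parallel:
  assumes "spacelike u" "spacelike v" "hyperplane u = hyperplane v" "p \<in> hyperplane u"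
  obtains c where "c \<noteq> 0" "v = c *\<^sub>R u"
proof -
  define c where "c = lorentz v u / lorentz u u"
  define w where "w = v - c *\<^sub>R u"
  have p: "lorentz u (vec_of p) = 0" "lorentz v (vec_of p) = 0"
    using assms(3,4) by (auto simp: hyperplane_def)
  have uw: "lorentz u w = 0" 
    using assms(1) by (simp add: w_def c_def lorentz_simps spacelike_def lorentz_commute[of u v])
  have wp: "lorentz w (vec_of p) = 0"
    by (simp add: w_def lorentz_simps p)
  have pw: "lorentz (vec_of p) w = 0"
    using wp by (simp add: lorentz_commute)
  have ww: "0 \<le> lorentz w w"
    using lorentz_orthogonal_nonneg(1)[OF wp] .
  let ?x = "sqrt (1 + lorentz w w) *\<^sub>R vec_of p + w"
  have "lorentz ?x ?x = -1"
    using ww by (simp add: lorentz_simps wp pw)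
  moreover have "lorentz ?x (vec_of p) < 0"
    using ww by (simp add: lorentz_simps wp)
  ultimately obtain x where x: "vec_of x = ?x"
    using exists_vec_of by blast
  have "x \<in> hyperplane u"
    by (simp add: hyperplane_def x lorentz_simps p uw)
  then have "lorentz v (vec_of x) = 0"
    unfolding assms(3) by (simp add: hyperplane_def)
  then have "lorentz v w = 0"
    by (simp add: x lorentz_simps p)
  then have "lorentz w w = 0"
    using uw by (subst w_def) (simp add: lorentz_simps)
  then have "v = c *\<^sub>R u"
    using lorentz_orthogonal_nonneg(2)[OF wp] by (simp add: w_def)
  moreover have "c \<noteq> 0"
    using assms(2) calculation by (auto simp: spacelike_def)
  ultimately show thesis by (rule that[rotated])
qed

lemma leichtweiss_width_eq:
  assumes "p \<in> interior K" "spacelike u" "p \<in> hyperplane u"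
    and "x \<in> K" "\<And>z. z \<in> K \<Longrightarrow> signed_dist u z \<le> signed_dist u x"
    and "y \<in> K" "\<And>z. z \<in> K \<Longrightarrow> signed_dist u y \<le> signed_dist u z"
  shows "leichtweiss_width K (p, hyperplane u) = signed_dist u x - signed_dist u y"
proof -
  let ?s = "signed_dist u"
  have pK: "p \<in> K"
    using assms(1) interior_subset by blast
  show ?thesis
    unfolding leichtweiss_width_def prod.case
  proof (rule the_equality)
    have "supporting_domain K u (?s x) (- ?s y)"
      unfolding supporting_domain_iff[OF assms(2) pK assms(3)] using assms(4-7) by auto
    then show "\<exists>v \<epsilon> \<epsilon>'. p \<in> interior K \<and> p \<in> hyperplane u \<and> spacelike v \<and>
        hyperplane u = hyperplane v \<and> supporting_domain K v \<epsilon> \<epsilon>' \<and> ?s x - ?s y = \<epsilon> + \<epsilon>'"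
      using assms(1-3) by (intro exI[of _ u] exI[of _ "?s x"] exI[of _ "- ?s y"]) simp
  next
    fix w
    assume "\<exists>v \<epsilon> \<epsilon>'. p \<in> interior K \<and> p \<in> hyperplane u \<and> spacelike v \<and>
      hyperplane u = hyperplane v \<and> supporting_domain K v \<epsilon> \<epsilon>' \<and> w = \<epsilon> + \<epsilon>'"
    then obtain v \<epsilon> \<epsilon>' where v: "spacelike v" "hyperplane u = hyperplane v"
      "supporting_domain K v \<epsilon> \<epsilon>'" and w: "w = \<epsilon> + \<epsilon>'"
      by blast
    obtain c where c: "c \<noteq> 0" "v = c *\<^sub>R u"
      using hyperplane_eq_imp_parallel[OF assms(2) v(1,2) assms(3)] .
    have sv: "signed_dist v z = sgn c * ?s z" for z
      using signed_dist_scaleR[OF assms(2) c(1)] c(2) by simp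
    have "p \<in> hyperplane v"
      using assms(3) v(2) by simp
    from v(3)[unfolded supporting_domain_iff[OF v(1) pK this]]
    obtain a b where ab: "a \<in> K" "sgn c * ?s a = \<epsilon>" "b \<in> K" "sgn c * ?s b = - \<epsilon>'"
      and bd: "\<And>z. z \<in> K \<Longrightarrow> - \<epsilon>' \<le> sgn c * ?s z" "\<And>z. z \<in> K \<Longrightarrow> sgn c * ?s z \<le> \<epsilon>"
      unfolding sv by blast
    \<comment> \<open>for \<open>c < 0\<close> the maximum and the minimum change roles\<close>
    show "w = ?s x - ?s y"
    proof (cases "0 < c")
      case True
      with ab bd[OF assms(4)] bd[OF assms(6)] assms(5)[OF ab(1)] assms(7)[OF ab(3)] w
      show ?thesis by simp
    next
      case False
      with c(1) have "sgn c = -1" by simp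
      with ab bd[OF assms(4)] bd[OF assms(6)] assms(5)[OF ab(3)] assms(7)[OF ab(1)] w
      show ?thesis by simp
    qed
  qed
qed

section \<open>The hyperplane through a point orthogonal to a line\<close>

lemma exists_spacelike_orthogonal:
  fixes p :: "'a::euclidean_space hyperbolic"
  shows "\<exists>u. spacelike u \<and> p \<in> hyperplane u"
proof -
  obtain b :: 'a where b: "b \<in> Basis"
    using nonempty_Basis by blast
  let ?z = "(b, 0::real)"
  \<comment> \<open>the projection of \<open>?z\<close> to the orthogonal complement of \<open>p\<close>; the sign is due to
    \<open>lorentz (vec_of p) (vec_of p) = -1\<close>\<close>
  let ?u = "?z + lorentz ?z (vec_of p) *\<^sub>R vec_of p"
  have up: "lorentz ?u (vec_of p) = 0"
    by (simp add: lorentz_simps)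
  have "?u \<noteq> 0"
  proof
    assume u: "?u = 0"
    then have "lorentz ?z (vec_of p) * snd (vec_of p) = 0"
      by (metis add_0 snd_add snd_conv snd_scaleR snd_zero real_scaleR_def)
    then have "lorentz ?z (vec_of p) = 0"
      using snd_vec_of_pos[of p] by simp
    with u b show False by (simp add: zero_prod_def)
  qed
  with up have "spacelike ?u"
    by (rule spacelike_if_orthogonal)
  moreover have "p \<in> hyperplane ?u"
    using up unfolding hyperplane_def by simp
  ultimately show ?thesis by blast
qed

text \<open>For \<open>x \<noteq> y\<close> the normal vector is taken in the span of \<open>x\<close> and \<open>y\<close>, which makes the
  hyperplane orthogonal to the line through these points.  Up to a factor, orthogonality to \<open>p\<close>
  determines it.\<close>

lemma exists_hyperplane_orthogonal_to_line:
  fixes p x y :: "'a::euclidean_space hyperbolic"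
  obtains u where "spacelike u" "p \<in> hyperplane u"
    "\<bar>signed_dist u x - signed_dist u y\<bar> = dist x y"
proof (cases "x = y")
  case True
  with exists_spacelike_orthogonal[of p] that show thesis by auto
next
  case False
  define a b C where "a = - lorentz (vec_of x) (vec_of p)"
    and "b = - lorentz (vec_of y) (vec_of p)"
    and "C = - lorentz (vec_of x) (vec_of y)"
  define u where "u = b *\<^sub>R vec_of x - a *\<^sub>R vec_of y"
  have a: "1 \<le> a" and b: "1 \<le> b" and C1: "1 \<le> C"
    unfolding a_def b_def C_def by (rule lorentz_vec_of_ge_1)+
  have "C \<noteq> 1"
    using lorentz_vec_of_eq_1_iff[of x y] False by (simp add: C_def)
  with C1 have C: "1 < C" by simp
  have xy: "lorentz (vec_of x) (vec_of y) = - C" "lorentz (vec_of y) (vec_of x) = - C"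
    by (simp_all add: C_def lorentz_commute)
  have up: "lorentz u (vec_of p) = 0"
    by (simp add: u_def lorentz_simps a_def b_def)
  have ux: "lorentz u (vec_of x) = a * C - b" and uy: "lorentz u (vec_of y) = a - b * C"
    by (simp_all add: u_def lorentz_simps xy)
  have uu: "lorentz u u = 2 * a * b * C - a\<^sup>2 - b\<^sup>2"
    by (simp add: u_def lorentz_simps xy algebra_simps power2_eq_square)
  have "u \<noteq> 0"
  proof
    assume "u = 0"
    with ux uy have "b = a * C" "a = b * C" by auto
    then have "b * 1 = b * C\<^sup>2" by (simp add: power2_eq_square)
    with b C show False by (simp add: power2_eq_1_iff)
  qed
  with up have sp: "spacelike u"
    by (rule spacelike_if_orthogonal)
  define N where "N = sqrt (lorentz u u)"
  have N: "0 < N" "N\<^sup>2 = 2 * a * b * C - a\<^sup>2 - b\<^sup>2"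
    using sp by (auto simp: N_def spacelike_def simp flip: uu)
  let ?s = "signed_dist u x" and ?t = "signed_dist u y"
  have sh: "N * sinh ?s = a * C - b" "N * sinh ?t = a - b * C"
    using lorentz_eq_sinh_signed_dist[OF sp] ux uy by (simp_all add: N_def)
  have cosh_sq: "(N * cosh r)\<^sup>2 = N\<^sup>2 + (N * sinh r)\<^sup>2" for r :: real
    using hyperbolic_pythagoras[of r] by (simp add: power_mult_distrib algebra_simps)
  \<comment> \<open>\<open>S\<close> is \<open>sinh (dist x y)\<close>\<close>
  define S where "S = sqrt (C\<^sup>2 - 1)"
  have S: "0 \<le> S" "S\<^sup>2 = C\<^sup>2 - 1"
    using C by (simp_all add: S_def)
  have "(N * cosh ?s)\<^sup>2 = (a * S)\<^sup>2"
    unfolding cosh_sq sh unfolding N(2) power_mult_distrib S(2)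
    by (simp add: algebra_simps power2_eq_square)
  then have chs: "N * cosh ?s = a * S"
    by (rule power2_eq_imp_eq) (use N(1) a S(1) in simp_all)
  have "(N * cosh ?t)\<^sup>2 = (b * S)\<^sup>2"
    unfolding cosh_sq sh unfolding N(2) power_mult_distrib S(2)
    by (simp add: algebra_simps power2_eq_square)
  then have cht: "N * cosh ?t = b * S"
    by (rule power2_eq_imp_eq) (use N(1) b S(1) in simp_all)
  have "N\<^sup>2 * cosh (?s - ?t) = (N * cosh ?s) * (N * cosh ?t) - (N * sinh ?s) * (N * sinh ?t)"
    by (simp add: cosh_diff power2_eq_square algebra_simps)
  also have "\<dots> = a * b * S\<^sup>2 - (a * C - b) * (a - b * C)"
    unfolding chs cht sh by (simp add: power2_eq_square)
  also have "\<dots> = N\<^sup>2 * C"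
    unfolding S(2) N(2) by (simp add: algebra_simps power2_eq_square)
  finally have "cosh (?s - ?t) = C"
    using N(1) by simp
  then have "dist x y = \<bar>?s - ?t\<bar>"
    unfolding dist_eq_iff_cosh C_def .
  with sp up show thesis
    by (intro that) (simp_all add: hyperplane_def)
qed

section \<open>Diameter and Leichtweiss width\<close>

theorem lemma6p3:
  fixes K :: "'a::euclidean_space hyperbolic set" and p :: "'a hyperbolic"
  assumes "DIM('a) \<ge> 2"
    and "convex_body K"
    and "p \<in> interior K"
  shows "diameter K \<in> {leichtweiss_width K (p, H) | H. is_hyperplane H \<and> p \<in> H} \<and>
    (\<forall>w \<in> {leichtweiss_width K (p, H) | H. is_hyperplane H \<and> p \<in> H}. w \<le> diameter K)"
proof -
  have K: "compact K" "K \<noteq> {}"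
    using assms(2,3) interior_subset by (auto simp: convex_body_def)
  have width_ge: "signed_dist u x - signed_dist u y \<le> leichtweiss_width K (p, hyperplane u)"
    and width_le: "leichtweiss_width K (p, hyperplane u) \<le> diameter K"
    if u: "spacelike u" "p \<in> hyperplane u" and xy: "x \<in> K" "y \<in> K" for u x y
  proof -
    obtain a where a: "a \<in> K" "\<And>z. z \<in> K \<Longrightarrow> signed_dist u z \<le> signed_dist u a"
      using continuous_attains_sup[OF K continuous_on_signed_dist[OF u(1)]] by blast
    obtain b where b: "b \<in> K" "\<And>z. z \<in> K \<Longrightarrow> signed_dist u b \<le> signed_dist u z"
      using continuous_attains_inf[OF K continuous_on_signed_dist[OF u(1)]] by blast
    have eq: "leichtweiss_width K (p, hyperplane u) = signed_dist u a - signed_dist u b"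
      using leichtweiss_width_eq[OF assms(3) u a b] .
    show "signed_dist u x - signed_dist u y \<le> leichtweiss_width K (p, hyperplane u)"
      unfolding eq using a(2)[OF xy(1)] b(2)[OF xy(2)] by simp
    have "signed_dist u a - signed_dist u b \<le> dist a b"
      using abs_signed_dist_diff_le_dist[OF u(1), of a b] by simp
    also have "\<dots> \<le> diameter K"
      using diameter_bounded_bound[OF compact_imp_bounded[OF K(1)] a(1) b(1)] .
    finally show "leichtweiss_width K (p, hyperplane u) \<le> diameter K"
      unfolding eq .
  qed
  obtain x y where xy: "x \<in> K" "y \<in> K" "dist x y = diameter K"
    using diameter_compact_attained[OF K] by blast
  obtain u where u: "spacelike u" "p \<in> hyperplane u"
    "\<bar>signed_dist u x - signed_dist u y\<bar> = dist x y"
    using exists_hyperplane_orthogonal_to_line by blast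
  have "leichtweiss_width K (p, hyperplane u) = diameter K"
    using width_ge[OF u(1,2) xy(1,2)] width_ge[OF u(1,2) xy(2,1)] width_le[OF u(1,2) xy(1,2)]
      u(3) xy(3)
    by linarith
  then have "diameter K \<in> {leichtweiss_width K (p, H) | H. is_hyperplane H \<and> p \<in> H}"
    using u(1,2) unfolding is_hyperplane_def by (metis (mono_tags, lifting) mem_Collect_eq)
  then show ?thesis
    using width_le xy(1,2) unfolding is_hyperplane_def by blast
qed

end
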